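(* Let $(B_k)_{k\ge 0}$ be the balancing sequence. The solutions of the Diophantine equation \[B_n^2-B_m^2=x^q\quad\text{with}\quad \gcd(B_n,B_m)=1,\quad q\ge 2,\] in integers $(n,m,x,q)$ with $n>m\ge 0$ and $x>0$ are $(n,m,x,q)=(1,0,1,k)$ with $k\ge 2$, and $(2,0,6,2)$.
   Context: The balancing sequence $(B_k)_{k\ge0}$ is defined by $B_0=0$, $B_1=1$ and $B_k=6B_{k-1}-B_{k-2}$ for $k\ge 2$; equivalently $B_k=\frac{\alpha^k-\beta^k}{4\sqrt2}$ with $\alpha=3+2\sqrt2$, $\beta=3-2\sqrt2$.
   Formalization: The listed tuple (2,0,6,2) has gcd(B_2,B_0)=6, so it fails the condition gcd(B_n,B_m)=1; for it only the equation B_2^2-B_0^2=6^2 is claimed, while every solution with gcd 1 is shown to be in the list. *)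

theory Defs
  imports Main
begin

fun balancing :: "nat \<Rightarrow> int" where
  "balancing 0 = 0"
| "balancing (Suc 0) = 1"
| "balancing (Suc (Suc k)) = 6 * balancing (Suc k) - balancing k"

end

theory Submission
  imports Defs "HOL-Computational_Algebra.Nth_Powers"
begin

text \<open>
  Write \<open>B\<close> for the balancing sequence and \<open>C\<close> for its companion, \<open>C^2 = 8 B^2 + 1\<close>. Since
  \<open>B_n^2 - B_m^2 = B_{n-m} B_{n+m}\<close>, \<open>B_{2k} = 2 B_k C_k\<close> and \<open>gcd(B_a, B_b) = B_{gcd(a,b)}\<close>, a
  coprime factor \<open>B_k\<close> with \<open>k\<close> odd can always be split off the product and is then a \<open>q\<close>-th power.
  For \<open>k = 2j + 1\<close> one has \<open>B_k = P Q\<close> with \<open>P = B_{j+1} - B_j\<close> and \<open>Q = B_{j+1} + B_j\<close> coprime and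
  \<open>Q^2 + 1 = 2 P^2\<close>, so a power \<open>B_k\<close> yields \<open>u^(2q) + 1 = 2 v^(2q)\<close>. For even \<open>q\<close> this is excluded
  by Fermat's descent for \<open>a^4 - b^4 = w^2\<close>. For odd \<open>q\<close> it is a case of Stormer's equation
  \<open>x^2 + 1 = 2 y^n\<close>: in the Gaussian integers \<open>x + i = (1 + i) z^n\<close> up to units, \<open>1 + i\<close> is divisible
  by \<open>z - l z'\<close> with \<open>z'\<close> the conjugate and \<open>l\<close> a unit, so \<open>Re z + Im z\<close> or \<open>Re z - Im z\<close> is 1 or -1,
  and a 2-adic comparison in the expansion of \<open>z^n\<close> leaves only units \<open>z\<close>. Hence \<open>k = 1\<close>.
\<close>

section \<open>Coprime factors of a perfect power\<close>

lemma coprime_mult_eq_power: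
  fixes a b c :: int
  assumes "coprime a b" "a * b = c ^ n" "a > 0" "b > 0" "c > 0"
  obtains d e where "d > 0" "e > 0" "a = d ^ n" "b = e ^ n"
proof -
  have root: "\<exists>d>0. x = d ^ n"
    if "coprime x y" "x * y = c ^ n" "x > 0" "y > 0" for x y :: int
  proof -
    have "nat x * nat y = nat c ^ n"
      using that assms(5) by (metis nat_mult_distrib nat_power_eq less_imp_le)
    moreover have "coprime (nat x) (nat y)"
      using that by (simp add: coprime_int_iff[symmetric])
    ultimately have "is_nth_power n (nat x)"
      using is_nth_power_mult_coprime_natD(1)[of "nat x" "nat y" n] that by simp
    then obtain d where d: "nat x = d ^ n"
      by (rule is_nth_powerE)
    show ?thesis
    proof (cases "n = 0")
      case True
      \<comment> \<open>For exponent 0 the root \<open>d\<close> found above may be 0, hence the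
        witness 1.\<close>
      with d show ?thesis by (intro exI[of _ 1]) (use that in auto)
    next
      case False
      have "d \<noteq> 0"
        using d False that by (metis power_0_left zero_less_nat_eq less_irrefl)
      moreover have "x = int d ^ n"
        using d that by (metis int_nat_eq less_imp_le of_nat_power)
      ultimately show ?thesis by (intro exI[of _ "int d"]) auto
    qed
  qed
  have "coprime b a" "b * a = c ^ n"
    using assms by (auto simp: coprime_commute mult.commute)
  with root[of a b] root[of b a] assms that show ?thesis by blast
qed

section \<open>Gaussian integers\<close>

datatype gauss = Gauss (gre: int) (gim: int)

lemma gauss_eqI: "gre z = gre w \<Longrightarrow> gim z = gim w \<Longrightarrow> z = w"
  by (rule gauss.expand) simp

lemma gauss_eq_iff: "z = w \<longleftrightarrow> gre z = gre w \<and> gim z = gim w"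
  by (auto intro: gauss_eqI)

instantiation gauss :: comm_ring_1
begin

definition "0 = Gauss 0 0"
definition "1 = Gauss 1 0"
definition "z + w = Gauss (gre z + gre w) (gim z + gim w)"
definition "- z = Gauss (- gre z) (- gim z)"
definition "z - w = Gauss (gre z - gre w) (gim z - gim w)"
definition "z * w = Gauss (gre z * gre w - gim z * gim w) (gre z * gim w + gim z * gre w)"

instance
  by standard
    (simp_all add: zero_gauss_def one_gauss_def plus_gauss_def uminus_gauss_def
      minus_gauss_def times_gauss_def gauss_eq_iff algebra_simps)

end

lemma gauss_sel [simp]:
  "gre 0 = 0" "gim 0 = 0" "gre 1 = 1" "gim 1 = 0"
  "gre (z + w) = gre z + gre w" "gim (z + w) = gim z + gim w"
  "gre (- z) = - gre z" "gim (- z) = - gim z"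
  "gre (z - w) = gre z - gre w" "gim (z - w) = gim z - gim w"
  "gre (z * w) = gre z * gre w - gim z * gim w"
  "gim (z * w) = gre z * gim w + gim z * gre w"
  by (simp_all add: zero_gauss_def one_gauss_def plus_gauss_def uminus_gauss_def
      minus_gauss_def times_gauss_def)

lemma of_nat_sel [simp]: "gre (of_nat k) = int k" "gim (of_nat k) = 0"
  by (induction k) simp_all

lemma of_int_sel [simp]: "gre (of_int k) = k" "gim (of_int k) = 0"
  by (cases k; simp)+

lemma numeral_sel [simp]: "gre (numeral k) = numeral k" "gim (numeral k) = 0"
  by (metis of_int_numeral of_int_sel)+

definition gi :: gauss where "gi = Gauss 0 1"

lemma gi_sel [simp]: "gre gi = 0" "gim gi = 1"
  by (simp_all add: gi_def)

lemma gi_square: "gi * gi = - 1"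
  by (simp add: gauss_eq_iff)

definition gcnj :: "gauss \<Rightarrow> gauss" where "gcnj z = Gauss (gre z) (- gim z)"

lemma gcnj_sel [simp]: "gre (gcnj z) = gre z" "gim (gcnj z) = - gim z"
  by (simp_all add: gcnj_def)

lemma gcnj_mult: "gcnj (z * w) = gcnj z * gcnj w"
  by (simp add: gauss_eq_iff algebra_simps)

lemma gcnj_power: "gcnj (z ^ n) = gcnj z ^ n"
  by (induction n) (simp_all add: gcnj_mult, simp add: gauss_eq_iff)

definition gnorm :: "gauss \<Rightarrow> int" where "gnorm z = (gre z)\<^sup>2 + (gim z)\<^sup>2"

lemma gnorm_mult: "gnorm (z * w) = gnorm z * gnorm w"
  by (simp add: gnorm_def power2_eq_square algebra_simps)

lemma gnorm_power: "gnorm (z ^ n) = gnorm z ^ n"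
  by (induction n) (simp_all add: gnorm_mult, simp add: gnorm_def)

lemma gnorm_nonneg: "gnorm z \<ge> 0"
  by (simp add: gnorm_def)

lemma gnorm_eq_0_iff: "gnorm z = 0 \<longleftrightarrow> z = 0"
  by (simp add: gnorm_def gauss_eq_iff sum_power2_eq_zero_iff)

lemma gnorm_gcnj: "gnorm (gcnj z) = gnorm z"
  by (simp add: gnorm_def)

lemma mult_gcnj: "z * gcnj z = of_int (gnorm z)"
  by (simp add: gauss_eq_iff gnorm_def power2_eq_square)

lemma gnorm_dvd: "z dvd w \<Longrightarrow> gnorm z dvd gnorm w"
  by (auto simp: dvd_def gnorm_mult)

lemma gcnj_dvd: "z dvd w \<Longrightarrow> gcnj z dvd gcnj w"
  by (auto simp: dvd_def gcnj_mult)

instance gauss :: idom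
proof
  fix z w :: gauss
  assume "z \<noteq> 0" "w \<noteq> 0"
  then show "z * w \<noteq> 0"
    using gnorm_mult[of z w] by (simp flip: gnorm_eq_0_iff)
qed

text \<open>Rounding both coordinates of \<open>z * gcnj d / gnorm d\<close> leaves errors of at
  most 1/2, so the remainder has at most half the norm of \<open>d\<close>.\<close>

lemma gauss_division:
  assumes "d \<noteq> 0"
  obtains q where "gnorm (z - q * d) < gnorm d"
proof -
  define N where "N = gnorm d"
  have N: "N > 0"
    using assms gnorm_nonneg[of d] gnorm_eq_0_iff[of d] by (simp add: N_def order_less_le)
  define t where "t = z * gcnj d"
  have "\<exists>q. 2 * \<bar>a - q * N\<bar> \<le> N" for a
  proof -
    \<comment> \<open>This is \<open>a / N\<close> rounded to the nearest integer, as the floor of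
      \<open>a / N + 1/2\<close>.\<close>
    define q where "q = (2 * a + N) div (2 * N)"
    define r where "r = (2 * a + N) mod (2 * N)"
    have "2 * a + N = 2 * (q * N) + r"
      using div_mult_mod_eq[of "2 * a + N" "2 * N"] by (simp only: q_def r_def ac_simps)
    moreover have "0 \<le> r" "r < 2 * N"
      using N by (simp_all add: r_def)
    ultimately have "\<bar>2 * (a - q * N)\<bar> \<le> N"
      by (simp only: abs_le_iff right_diff_distrib) linarith
    then have "2 * \<bar>a - q * N\<bar> \<le> N"
      by (simp only: abs_mult)
    then show ?thesis by blast
  qed
  then obtain f where f: "\<And>a. 2 * \<bar>a - f a * N\<bar> \<le> N" by metis
  define q where "q = Gauss (f (gre t)) (f (gim t))"
  have sq: "4 * (a - f a * N)\<^sup>2 \<le> N\<^sup>2" for a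
    using power_mono[OF f[of a], of 2] by (simp add: power_mult_distrib)
  have "(z - q * d) * gcnj d = t - q * of_int N"
    by (simp add: t_def algebra_simps N_def flip: mult_gcnj)
  then have "gnorm (z - q * d) * N = gnorm (t - q * of_int N)"
    by (metis gnorm_mult gnorm_gcnj N_def)
  moreover have "gnorm (t - q * of_int N)
      = (gre t - f (gre t) * N)\<^sup>2 + (gim t - f (gim t) * N)\<^sup>2"
    by (simp add: gnorm_def q_def)
  ultimately have "4 * (gnorm (z - q * d) * N) \<le> 2 * N\<^sup>2"
    using sq[of "gre t"] sq[of "gim t"] by simp
  then have "2 * gnorm (z - q * d) * N \<le> N * N"
    unfolding power2_eq_square by linarith
  then have "2 * gnorm (z - q * d) \<le> N"
    using N by (simp only: mult_le_cancel_right_pos)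
  then have "gnorm (z - q * d) < gnorm d"
    using N gnorm_nonneg[of "z - q * d"] by (simp add: N_def)
  then show ?thesis by (rule that)
qed

text \<open>A nonzero combination of least norm divides every combination, because the remainder of
  a division by it is again a combination.\<close>

lemma gauss_bezout:
  fixes w y :: gauss
  obtains z s t where "z = s * w + t * y" "z dvd w" "z dvd y"
proof (cases "w = 0 \<and> y = 0")
  case True
  then show ?thesis using that[of 0 0 0] by simp
next
  case False
  define S where "S = {s * w + t * y | s t. s * w + t * y \<noteq> 0}"
  have "w \<in> S \<or> y \<in> S"
    unfolding S_def mem_Collect_eq using False
    by (metis add.left_neutral add.right_neutral mult_1 mult_zero_left)
  then obtain x where "x \<in> S" by blast
  define z where "z = arg_min (\<lambda>z. nat (gnorm z)) (\<lambda>z. z \<in> S)"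
  have zS: "z \<in> S" and min: "nat (gnorm z) \<le> nat (gnorm x)" if "x \<in> S" for x
    using arg_min_nat_lemma[of "\<lambda>z. z \<in> S", OF that, of "\<lambda>z. nat (gnorm z)"] that by (auto simp: z_def)
  from zS[OF \<open>x \<in> S\<close>] obtain s t where z: "z = s * w + t * y" "z \<noteq> 0"
    unfolding S_def by blast
  have dvd: "z dvd a * w + b * y" for a b
  proof -
    obtain q where q: "gnorm (a * w + b * y - q * z) < gnorm z"
      using gauss_division[OF z(2)] by blast
    have "a * w + b * y - q * z = (a - q * s) * w + (b - q * t) * y"
      by (simp add: z(1) algebra_simps)
    then have "a * w + b * y - q * z \<in> S \<or> a * w + b * y - q * z = 0"
      unfolding S_def mem_Collect_eq by metis
    moreover have "a * w + b * y - q * z \<notin> S"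
      using min[of "a * w + b * y - q * z"] q gnorm_nonneg[of "a * w + b * y - q * z"]
      by linarith
    ultimately show ?thesis by (simp add: dvd_def mult.commute)
  qed
  show ?thesis
    using that[OF z(1)] dvd[of 1 0] dvd[of 0 1] by simp
qed

text \<open>With \<open>z = gcd(w, y)\<close>, the relation \<open>z = s w + t y\<close> gives that \<open>w\<close> divides \<open>z^n\<close>, and
comaximality of \<open>w\<close> with its conjugate gives \<open>gnorm z dvd y\<close>; comparing norms, the cofactor is a
unit. This avoids unique factorization.\<close>

lemma gauss_power_extraction:
  assumes "a * w + b * gcnj w = 1" "gnorm w = y ^ n" "y > 0"
  obtains z u where "gnorm u = 1" "w * u = z ^ n"
proof -
  obtain z s t where z: "z = s * w + t * of_int y" "z dvd w" "z dvd of_int y"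
    using gauss_bezout[of w "of_int y"] by blast
  have "w dvd of_int y ^ n"
    using mult_gcnj[of w] assms(2) by (metis dvd_triv_left of_int_power)
  then have "w dvd (t * of_int y) ^ n"
    by (simp add: power_mult_distrib)
  moreover have "w dvd z ^ n - (t * of_int y) ^ n"
  proof -
    have "z - t * of_int y dvd z ^ n - (t * of_int y) ^ n"
      by (metis dvd_triv_left power_diff_sumr2)
    then show ?thesis by (rule dvd_trans[rotated]) (simp add: z(1))
  qed
  ultimately have "w dvd z ^ n"
    by (metis dvd_add diff_add_cancel)
  then obtain u where u: "z ^ n = w * u" by (auto simp: dvd_def)
  obtain z' where z': "w = z * z'" using z(2) by (auto simp: dvd_def)
  have cz: "gcnj z dvd of_int y"
    using gcnj_dvd[OF z(3)] by (simp add: gcnj_def gauss_eq_iff dvd_def)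
  \<comment> \<open>Multiplying comaximality by \<open>y\<close> makes each summand a multiple of
    \<open>z * gcnj z\<close>: both \<open>z\<close> and \<open>gcnj z\<close> divide
    \<open>y\<close>, which is its own conjugate.\<close>
  have "of_int y = a * w * of_int y + b * gcnj w * of_int y"
    by (metis assms(1) distrib_right mult_1)
  moreover have "z * gcnj z dvd w * of_int y"
    using z(2) cz by (rule mult_dvd_mono)
  moreover have "z * gcnj z dvd gcnj w * of_int y"
    using mult_dvd_mono[OF gcnj_dvd[OF z(2)] z(3)] by (simp add: mult.commute)
  ultimately have "z * gcnj z dvd of_int y"
    by (metis dvd_add dvd_mult mult.assoc)
  then have "(of_int (gnorm z) :: gauss) dvd of_int y"
    by (simp add: mult_gcnj)
  then have "gnorm z dvd y"
    by (auto simp: dvd_def gauss_eq_iff)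
  then have "gnorm z ^ n dvd y ^ n" by (rule dvd_power_same)
  moreover have "gnorm z ^ n = y ^ n * gnorm u"
    using u assms(2) by (metis gnorm_mult gnorm_power)
  ultimately have "y ^ n * gnorm u dvd y ^ n * 1" by simp
  then have "gnorm u dvd 1"
    using assms(3) by (simp only: dvd_mult_cancel_left) simp
  then have "gnorm u = 1"
    using gnorm_nonneg[of u] by (simp add: zdvd1_eq)
  with u that show ?thesis by metis
qed

section \<open>Powers of Gaussian integers on the lines Re + Im = 1 and Re - Im = 1\<close>

lemma one_plus_power_expansion:
  fixes d :: "'a :: comm_ring_1"
  shows "\<exists>e. (1 + d) ^ n = 1 + of_nat n * d + d\<^sup>2 * e"
proof (induction n)
  case 0
  show ?case by (intro exI[of _ 0]) simp
next
  case (Suc n)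
  then obtain e where "(1 + d) ^ n = 1 + of_nat n * d + d\<^sup>2 * e" by blast
  then have "(1 + d) ^ Suc n = 1 + of_nat (Suc n) * d + d\<^sup>2 * (of_nat n + e + d * e)"
    by (simp add: power2_eq_square algebra_simps)
  then show ?case by blast
qed

text \<open>The base is \<open>1 + b(1 + i)\<close>, and \<open>Re + Im\<close> of its power is
  \<open>1 + 2b(n + bc)\<close> for some integer \<open>c\<close>. The inner factor is odd, and an
  even \<open>b\<close> excludes the value -1.\<close>

lemma diagonal_power_eq_unit:
  assumes "even b" "odd n" "\<bar>gre (Gauss (1 + b) b ^ n) + gim (Gauss (1 + b) b ^ n)\<bar> = 1"
  shows "b = 0"
proof -
  define d where "d = Gauss b b"
  have "Gauss (1 + b) b = 1 + d"
    by (simp add: d_def gauss_eq_iff)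
  moreover obtain e where "(1 + d) ^ n = 1 + of_nat n * d + d\<^sup>2 * e"
    using one_plus_power_expansion by blast
  moreover have "d\<^sup>2 = Gauss 0 (2 * b\<^sup>2)"
    by (simp add: d_def gauss_eq_iff power2_eq_square)
  ultimately have sum: "gre (Gauss (1 + b) b ^ n) + gim (Gauss (1 + b) b ^ n)
      = 1 + 2 * (b * (int n + b * (gre e - gim e)))"
    by (simp add: d_def power2_eq_square algebra_simps)
  have "odd (int n + b * (gre e - gim e))"
    using assms by simp
  then have "int n + b * (gre e - gim e) \<noteq> 0" by (metis even_zero)
  moreover have "b * (int n + b * (gre e - gim e)) \<noteq> - 1"
    using assms(1) by (metis dvd_mult2 even_minus odd_one)
  then have "b * (int n + b * (gre e - gim e)) = 0"
    using assms(3) unfolding sum by linarith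
  ultimately show ?thesis by simp
qed

text \<open>Here \<open>z = 1 + b(i - 1)\<close>, and the first-order term of \<open>z^m\<close> does not contribute to
\<open>Re + Im\<close>. The expansion is therefore carried to second order, for \<open>m\<close> a power of 2: this is the
2-adic order of \<open>n - 1\<close> below.\<close>

lemma antidiagonal_power_two_power:
  assumes "even b"
  shows "\<exists>e. Gauss (1 - b) b ^ (2 ^ Suc s) =
    1 + of_int (2 ^ Suc s * b) * (gi - 1) + of_int (2 ^ Suc s * b\<^sup>2) * gi
      + of_int (2 ^ Suc s * b\<^sup>2) * 2 * e"
proof (induction s)
  case 0
  \<comment> \<open>The square contributes \<open>-2 b^2 i\<close>; writing it as
    \<open>2 b^2 i - 4 b^2 i\<close> gives the witness \<open>- gi\<close>.\<close>
  have "Gauss (1 - b) b ^ (2 ^ Suc 0) =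
    1 + of_int (2 ^ Suc 0 * b) * (gi - 1) + of_int (2 ^ Suc 0 * b\<^sup>2) * gi
      + of_int (2 ^ Suc 0 * b\<^sup>2) * 2 * (- gi)"
    by (simp add: gauss_eq_iff power2_eq_square algebra_simps)
  then show ?case by blast
next
  case (Suc s)
  define k :: gauss where "k = of_int (2 ^ s)"
  define B :: gauss where "B = of_int b"
  obtain c where c: "b = 2 * c" using assms by (rule evenE)
  define C :: gauss where "C = of_int c"
  have B: "B = 2 * C" by (simp add: B_def C_def c)
  from Suc obtain e where e: "Gauss (1 - b) b ^ (2 ^ Suc s) =
    1 + 2 * k * B * (gi - 1) + 2 * k * B\<^sup>2 * gi + 2 * k * B\<^sup>2 * 2 * e"
    by (auto simp: k_def B_def)
  \<comment> \<open>The part after 1 is \<open>2kB((i - 1) + 2J)\<close>, and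
    \<open>(i - 1)^2 = -2i\<close> makes its square \<open>8 k^2 B^2 H\<close>, which enters only
    the error term.\<close>
  define J where "J = C * (gi + 2 * e)"
  define H where "H = - gi + 2 * J * (gi - 1) + 2 * J\<^sup>2"
  have "Gauss (1 - b) b ^ (2 ^ Suc (Suc s)) = (Gauss (1 - b) b ^ (2 ^ Suc s))\<^sup>2"
    by (simp add: power_mult[symmetric] mult.commute)
  also have "\<dots> = 1 + 4 * k * B * (gi - 1) + 4 * k * B\<^sup>2 * gi
      + 4 * k * B\<^sup>2 * 2 * (e + k * H)"
    unfolding e H_def J_def B using gi_square by algebra
  finally show ?case
    by (intro exI[of _ "e + k * H"]) (simp add: k_def B_def)
qed

text \<open>With \<open>n - 1 = 2^(s+1) t\<close> and \<open>t\<close> odd, the multiples of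
  \<open>i - 1\<close> drop out of \<open>Re + Im\<close>, leaving 1 plus \<open>2^(s+1) b^2\<close>
  times an odd number. For \<open>n = 1\<close> the sum would be 1 for every
  \<open>b\<close>.\<close>

lemma antidiagonal_power_eq_unit:
  assumes "even b" "odd n" "n \<noteq> 1"
    "\<bar>gre (Gauss (1 - b) b ^ n) + gim (Gauss (1 - b) b ^ n)\<bar> = 1"
  shows "b = 0"
proof -
  have "n - 1 \<noteq> 0" using assms(2,3) by (cases n) auto
  then obtain t where t: "n - 1 = 2 ^ multiplicity 2 (n - 1) * t" "odd t"
    using multiplicity_decompose'[of "n - 1" 2] by auto
  have "even (n - 1)" using assms(2) by simp
  then have "multiplicity 2 (n - 1) \<noteq> 0"
    using t by (metis mult_1 power_0)
  then obtain s where s: "multiplicity 2 (n - 1) = Suc s"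
    by (cases "multiplicity 2 (n - 1)") auto
  have n: "n = 1 + 2 ^ Suc s * t"
    using t(1) \<open>n - 1 \<noteq> 0\<close> unfolding s by linarith
  define k :: gauss where "k = of_int (2 ^ s)"
  define B :: gauss where "B = of_int b"
  define T :: gauss where "T = of_nat t"
  obtain c where c: "b = 2 * c" using assms(1) by (rule evenE)
  define C :: gauss where "C = of_int c"
  have B: "B = 2 * C" by (simp add: B_def C_def c)
  obtain e where e: "Gauss (1 - b) b ^ (2 ^ Suc s) =
    1 + (2 * k * B * (gi - 1) + 2 * k * B\<^sup>2 * gi + 2 * k * B\<^sup>2 * 2 * e)"
    using antidiagonal_power_two_power[OF assms(1), of s]
    by (auto simp: k_def B_def add.assoc)
  define F where "F = 2 * k * B * (gi - 1) + 2 * k * B\<^sup>2 * gi + 2 * k * B\<^sup>2 * 2 * e"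
  obtain e' where e': "(1 + F) ^ t = 1 + T * F + F\<^sup>2 * e'"
    using one_plus_power_expansion[of F t] by (auto simp: T_def)
  define J where "J = C * (gi + 2 * e)"
  define H where "H = - gi + 2 * J * (gi - 1) + 2 * J\<^sup>2"
  have F2: "F\<^sup>2 = 8 * k\<^sup>2 * B\<^sup>2 * H"
    unfolding F_def H_def J_def B using gi_square by algebra
  \<comment> \<open>\<open>R\<close> gathers the cofactors of \<open>2(2kB^2)\<close>: from the
    earlier error \<open>e\<close>, from the quadratic remainder, and from the products of
    \<open>B(i - 1)\<close> with the three parts of \<open>T * F\<close>.\<close>
  define R where "R = T * e + (1 + B * (gi - 1)) * 2 * k * H * e'
    + T * (- gi) + T * C * gi * (gi - 1) + T * B * (gi - 1) * e"
  have "Gauss (1 - b) b = 1 + B * (gi - 1)"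
    by (simp add: B_def gauss_eq_iff)
  then have "Gauss (1 - b) b ^ n = (1 + B * (gi - 1)) * (1 + T * F + F\<^sup>2 * e')"
    unfolding n power_add power_mult e F_def[symmetric] e' by simp
  also have "\<dots> = 1 + B * (1 + 2 * k * T) * (gi - 1) + T * (2 * k * B\<^sup>2) * gi
      + 2 * (2 * k * B\<^sup>2) * R"
    unfolding F2 unfolding F_def R_def B using gi_square by algebra
  finally have expansion: "Gauss (1 - b) b ^ n = \<dots>" .
  have sel: "gre k = 2 ^ s" "gim k = 0" "gre B = b" "gim B = 0" "gre T = int t" "gim T = 0"
    by (simp_all only: k_def B_def T_def of_int_sel of_nat_sel)
  have sum: "gre (Gauss (1 - b) b ^ n) + gim (Gauss (1 - b) b ^ n)
      = 1 + 2 * (2 ^ s * b\<^sup>2 * (int t + 2 * (gre R + gim R)))"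
    unfolding expansion by (simp add: sel power2_eq_square algebra_simps)
  have "2 ^ s * b\<^sup>2 * (int t + 2 * (gre R + gim R)) \<noteq> - 1"
    using assms(1) by (metis dvd_mult dvd_mult2 even_minus even_power odd_one zero_less_numeral)
  then have "2 ^ s * b\<^sup>2 * (int t + 2 * (gre R + gim R)) = 0"
    using assms(4) unfolding sum by linarith
  moreover have "odd (int t + 2 * (gre R + gim R))"
    using t(2) by simp
  then have "int t + 2 * (gre R + gim R) \<noteq> 0" by (metis even_zero)
  ultimately show ?thesis by simp
qed

text \<open>For odd \<open>n\<close>, negating \<open>z\<close> or swapping its coordinates changes
  \<open>Re + Im\<close> of \<open>z^n\<close> at most in sign. This reduces to even
  \<open>Im z\<close> on the lines \<open>Re + Im = 1\<close> and
  \<open>Re - Im = 1\<close>.\<close>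

lemma gauss_power_eq_unit:
  assumes "odd n" "n \<noteq> 1" "\<bar>gre (z ^ n) + gim (z ^ n)\<bar> = 1"
    and "\<bar>gre z + gim z\<bar> = 1 \<or> \<bar>gre z - gim z\<bar> = 1"
  shows "gnorm z = 1"
proof -
  have even_im: "gim z = 0"
    if ev: "even (gim z)" and one: "gre z + gim z = 1 \<or> gre z - gim z = 1"
      and s: "\<bar>gre (z ^ n) + gim (z ^ n)\<bar> = 1" for z
    using one
  proof
    assume "gre z + gim z = 1"
    then have "z = Gauss (1 - gim z) (gim z)"
      by (simp add: gauss_eq_iff)
    then show ?thesis
      using antidiagonal_power_eq_unit[OF ev assms(1,2)] s by metis
  next
    assume "gre z - gim z = 1"
    then have "z = Gauss (1 + gim z) (gim z)"
      by (simp add: gauss_eq_iff)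
    then show ?thesis
      using diagonal_power_eq_unit[OF ev assms(1)] s by metis
  qed
  have even_im': "gim z = 0"
    if ev: "even (gim z)" and one: "\<bar>gre z + gim z\<bar> = 1 \<or> \<bar>gre z - gim z\<bar> = 1"
      and s: "\<bar>gre (z ^ n) + gim (z ^ n)\<bar> = 1" for z
  proof (cases "gre z + gim z = 1 \<or> gre z - gim z = 1")
    case True
    then show ?thesis using even_im ev s by blast
  next
    case False
    then have "gre (- z) + gim (- z) = 1 \<or> gre (- z) - gim (- z) = 1"
      using one by auto
    moreover have "\<bar>gre ((- z) ^ n) + gim ((- z) ^ n)\<bar> = 1"
      using s assms(1) by (simp add: power_minus_odd abs_if split: if_splits)
    ultimately have "gim (- z) = 0"
      using even_im[of "- z"] ev by simp
    then show ?thesis by simp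
  qed
  show ?thesis
  proof (cases "even (gim z)")
    case True
    from even_im'[OF this assms(4,3)] assms(4) show ?thesis
      by (simp add: gnorm_def abs_square_eq_1)
  next
    case False
    \<comment> \<open>Swapping real and imaginary part preserves \<open>Re + Im\<close> of odd powers up to sign.\<close>
    define z' where "z' = gi * gcnj z"
    have z': "gre z' = gim z" "gim z' = gre z" by (simp_all add: z'_def)
    have "odd (gre z + gim z) \<or> odd (gre z - gim z)"
      using assms(4) by (metis abs_eq_iff' even_minus odd_one)
    with False have ev: "even (gim z')" by (auto simp: z')
    obtain k where k: "n = 2 * k + 1" using assms(1) by (rule oddE)
    have "gi\<^sup>2 = - 1" by (simp add: power2_eq_square gi_square)
    then have "gi ^ n = (- 1) ^ k * gi"
      by (simp add: k power_mult)
    then have "z' ^ n = (- 1) ^ k * (gi * gcnj (z ^ n))"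
      by (simp add: z'_def power_mult_distrib gcnj_power)
    then have "\<bar>gre (z' ^ n) + gim (z' ^ n)\<bar> = 1"
      using assms(3) by (cases "even k") (simp_all add: add.commute abs_if split: if_splits)
    moreover have "\<bar>gre z' + gim z'\<bar> = 1 \<or> \<bar>gre z' - gim z'\<bar> = 1"
      using assms(4) by (simp add: z' add.commute abs_minus_commute)
    ultimately have "gim z' = 0" using even_im' ev by blast
    with assms(4) show ?thesis
      by (simp add: z' gnorm_def abs_square_eq_1)
  qed
qed

section \<open>The equation u^(2q) + 1 = 2 v^(2q)\<close>

lemma gauss_unit_power4:
  assumes "gnorm u = 1"
  shows "u ^ 4 = 1"
proof -
  have "(gre u)\<^sup>2 \<le> 1" "(gim u)\<^sup>2 \<le> 1"
    using assms unfolding gnorm_def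
    by (metis le_add_same_cancel1 le_add_same_cancel2 zero_le_power2)+
  then have "gre u \<in> {-1, 0, 1}" "gim u \<in> {-1, 0, 1}"
    by (auto simp: abs_square_le_1 abs_if split: if_splits)
  with assms show ?thesis
    by (auto simp: gnorm_def gauss_eq_iff eval_nat_numeral)
qed

text \<open>An odd square is 1 modulo 4. Thus \<open>u^n\<close> is an n-th root of
  \<open>u\<close>, which lets units be absorbed into n-th powers.\<close>

lemma power_odd_square_of_fourth_root_unity:
  fixes u :: "'a :: monoid_mult"
  assumes "u ^ 4 = 1" "odd n"
  shows "u ^ (n * n) = u"
proof -
  obtain t where "n = 2 * t + 1" using assms(2) by (rule oddE)
  then have "n * n = 4 * (t * t + t) + 1" by (simp add: algebra_simps)
  then show ?thesis
    using assms(1) by (simp only: power_add power_mult) simp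
qed

lemma square_plus_one_eq_twice_power:
  fixes x y :: int
  assumes eq: "x\<^sup>2 + 1 = 2 * y ^ n" and n: "odd n" "n \<noteq> 1" and y: "y > 0"
  shows "y = 1"
proof -
  have "odd (x\<^sup>2)"
    using eq by (metis dvd_triv_left even_plus_one_iff)
  then obtain h where h: "x = 2 * h + 1" by (auto elim: oddE)
  \<comment> \<open>\<open>w = (x + i) / (1 + i)\<close>\<close>
  define w where "w = Gauss (h + 1) (- h)"
  have yn: "y ^ n = 2 * (h\<^sup>2 + h) + 1"
    using eq unfolding h by (simp add: power2_eq_square algebra_simps)
  then have norm_w: "gnorm w = y ^ n"
    by (simp add: gnorm_def w_def power2_eq_square algebra_simps)
  define k :: gauss where "k = of_int (h\<^sup>2 + h)"
  have "w * gcnj w = 2 * k + 1"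
    unfolding mult_gcnj norm_w yn k_def by simp
  moreover have "(1 - gi) * w + (1 + gi) * gcnj w = 2"
    by (simp add: gauss_eq_iff w_def)
  \<comment> \<open>The ideal of \<open>w\<close> and its conjugate contains \<open>2k + 1\<close>
    and 2; subtract \<open>k\<close> times the latter from the former.\<close>
  ultimately have "(gcnj w - k * (1 - gi)) * w + (- k * (1 + gi)) * gcnj w = 1"
    by algebra
  then obtain z u where u: "gnorm u = 1" and zu: "w * u = z ^ n"
    using gauss_power_extraction[OF _ norm_w y] by blast
  \<comment> \<open>\<open>u^(3n)\<close> is an n-th root of \<open>u^3\<close>, the inverse of
    \<open>u\<close>.\<close>
  define z0 where "z0 = z * u ^ (3 * n)"
  have "z0 ^ n = z ^ n * (u ^ (n * n)) ^ 3"
    by (simp add: z0_def power_mult_distrib mult_ac flip: power_mult)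
  also have "\<dots> = w * u ^ 4"
    using power_odd_square_of_fourth_root_unity[OF gauss_unit_power4[OF u] n(1)]
    by (simp add: eval_nat_numeral mult_ac flip: zu)
  finally have z0: "z0 ^ n = w"
    by (simp add: gauss_unit_power4[OF u])
  \<comment> \<open>\<open>l\<close> is an \<open>n\<close>-th root of \<open>-i\<close>, so that \<open>1 + i\<close> becomes a difference of two \<open>n\<close>-th powers.\<close>
  define l where "l = (- gi) ^ n"
  have "gnorm (- gi) = 1" by (simp add: gnorm_def)
  then have ln: "l ^ n = - gi"
    using power_odd_square_of_fourth_root_unity[OF gauss_unit_power4 n(1)]
    by (simp add: l_def power_mult)
  have "z0 - l * gcnj z0 dvd z0 ^ n - (l * gcnj z0) ^ n"
    by (metis dvd_triv_left power_diff_sumr2)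
  also have "z0 ^ n - (l * gcnj z0) ^ n = w - (- gi) * gcnj w"
    by (simp add: power_mult_distrib ln z0 flip: gcnj_power)
  also have "\<dots> = 1 + gi"
    by (simp add: w_def gauss_eq_iff)
  finally have "gnorm (z0 - l * gcnj z0) dvd 2"
    by (auto dest: gnorm_dvd simp: gnorm_def)
  \<comment> \<open>Since \<open>l\<close> is \<open>i\<close> or \<open>-i\<close>, the two
    coordinates of the difference agree up to sign, so its norm is twice a square.\<close>
  moreover have "gnorm (z0 - l * gcnj z0) = 2 * (gre z0 + gim z0)\<^sup>2
      \<or> gnorm (z0 - l * gcnj z0) = 2 * (gre z0 - gim z0)\<^sup>2"
  proof -
    obtain t where t: "n = 2 * t + 1" using n(1) by (rule oddE)
    have "gi\<^sup>2 = - 1" by (simp add: power2_eq_square gi_square)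
    then have "l = (- 1) ^ t * - gi"
      by (simp add: l_def t power_mult)
    then have "l = gi \<or> l = - gi" by (cases "even t") auto
    then show ?thesis
      by (auto simp: gnorm_def power2_eq_square algebra_simps)
  qed
  ultimately have "(gre z0 + gim z0)\<^sup>2 dvd 1 \<or> (gre z0 - gim z0)\<^sup>2 dvd 1"
    by auto
  then have "\<bar>gre z0 + gim z0\<bar> = 1 \<or> \<bar>gre z0 - gim z0\<bar> = 1"
    by (simp add: zdvd1_eq abs_square_eq_1)
  moreover have "\<bar>gre (z0 ^ n) + gim (z0 ^ n)\<bar> = 1"
    by (simp add: z0 w_def)
  ultimately have "gnorm z0 = 1"
    using gauss_power_eq_unit[OF n] by blast
  then have "y ^ n = 1"
    using z0 norm_w by (metis gnorm_power power_one)
  then show ?thesis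
    using y n by (metis odd_pos order_less_imp_le power_eq_iff_eq_base power_one zero_le_one)
qed

text \<open>Descent on \<open>a\<close>: splitting \<open>b^4 = (a^2 - w)(a^2 + w)\<close> leads to
  \<open>a^2 = 4 s^4 + t^4\<close>, and splitting \<open>4 s^4 = (a - t^2)(a + t^2)\<close> leads to
  \<open>g^4 - h^4 = t^2\<close> with \<open>g < a\<close> and \<open>t\<close> odd.\<close>

lemma no_biquadrate_difference_odd_square:
  fixes a b w :: int
  assumes "coprime a b" "a ^ 4 - b ^ 4 = w\<^sup>2" "odd w" "a > 0" "b > 0" "w > 0"
  shows False
  using assms
proof (induction "nat a" arbitrary: a b w rule: less_induct)
  case less
  note cop = less.prems(1) and eq = less.prems(2) and w = less.prems(3,6) and ab = less.prems(4,5)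
  have "even b" "odd a"
  proof -
    have "odd (a ^ 4 - b ^ 4)" using eq w by simp
    then have par: "even a \<longleftrightarrow> odd b" by auto
    show "even b"
    proof (rule ccontr)
      assume "odd b"
      with par obtain a' b' w' where "a = 2 * a'" "b = 2 * b' + 1" "w = 2 * w' + 1"
        using w by (auto elim!: evenE oddE)
      \<comment> \<open>For even \<open>a\<close> and odd \<open>b\<close> the square
        \<open>w^2\<close> would be -1 modulo 4.\<close>
      then have "(2 * a') ^ 4 - (2 * b' + 1) ^ 4 = (2 * w' + 1)\<^sup>2" using eq by simp
      then have "4 * (4 * a' ^ 4 - (4 * b' ^ 4 + 8 * b' ^ 3 + 6 * b'\<^sup>2 + 2 * b') - w'\<^sup>2 - w') = 2"
        by (simp add: eval_nat_numeral algebra_simps)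
      then show False by presburger
    qed
    with par show "odd a" by simp
  qed
  then obtain k where k: "b = 2 * k" by (auto elim: evenE)
  have kpos: "k > 0" using ab k by simp
  have "even (a\<^sup>2 - w)" using \<open>odd a\<close> w by simp
  then obtain P where P: "a\<^sup>2 - w = 2 * P" by (rule evenE)
  define R where "R = P + w"
  have a2: "a\<^sup>2 = P + R" using P by (simp add: R_def)
  have PR: "P * R = (2 * k\<^sup>2)\<^sup>2"
  proof -
    have "4 * (P * R) = a ^ 4 - w\<^sup>2"
      using P a2 unfolding R_def by algebra
    also have "\<dots> = 4 * (2 * k\<^sup>2)\<^sup>2" using eq k by algebra
    finally show ?thesis by simp
  qed
  have "P * R > 0" unfolding PR using kpos by simp
  moreover have "R > P" using w by (simp add: R_def)
  moreover have "P + R > 0" using ab by (simp flip: a2)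
  ultimately have pos: "P > 0" "R > 0"
    by (auto simp: zero_less_mult_iff)
  have "coprime P R"
  proof -
    have "P dvd b ^ 4"
      using PR k by (intro dvdI[of _ _ "4 * R"]) algebra
    moreover have "coprime (b ^ 4) (a\<^sup>2)" using cop by (simp add: coprime_commute)
    ultimately have "coprime P (P + R)"
      unfolding a2 by (rule coprime_divisors[OF _ dvd_refl])
    then show ?thesis
      by (simp only: coprime_iff_gcd_eq_1 gcd_add2)
  qed
  then obtain p r where pr: "p > 0" "r > 0" "P = p\<^sup>2" "R = r\<^sup>2"
    using coprime_mult_eq_power[OF _ PR pos] kpos by auto
  have "(p * r)\<^sup>2 = (2 * k\<^sup>2)\<^sup>2"
    using PR by (simp only: pr power_mult_distrib)
  then have prk: "p * r = 2 * k\<^sup>2"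
    by (rule power2_eq_imp_eq) (use pr in auto)
  have cpr: "coprime p r" using \<open>coprime P R\<close> pr by simp
  \<comment> \<open>As \<open>p * r = 2 * k^2\<close>, one of \<open>p\<close>, \<open>r\<close> is
    even; halving it leaves coprime factors of a square. Quantifying over both covers either
    order.\<close>
  have step: "\<exists>s t. s > 0 \<and> t > 0 \<and> coprime s t \<and> p\<^sup>2 + r\<^sup>2 = 4 * s ^ 4 + t ^ 4"
    if "even p" "p * r = 2 * k\<^sup>2" "coprime p r" "p > 0" "r > 0" for p r
  proof -
    from \<open>even p\<close> obtain p' where p': "p = 2 * p'" by (rule evenE)
    have "coprime p' r" "p' * r = k\<^sup>2" "p' > 0"
      using that p' by auto
    then obtain s t where st: "s > 0" "t > 0" "p' = s\<^sup>2" "r = t\<^sup>2"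
      using coprime_mult_eq_power[of p' r k 2] kpos \<open>r > 0\<close> by blast
    then have "coprime s t" "p\<^sup>2 + r\<^sup>2 = 4 * s ^ 4 + t ^ 4"
      using \<open>coprime p' r\<close> by (auto simp: p' power_mult_distrib simp flip: power_mult)
    with st show ?thesis by blast
  qed
  have "even p \<or> even r"
    using prk by (metis dvd_triv_left even_mult_iff)
  then obtain s t where st: "s > 0" "t > 0" "coprime s t" "a\<^sup>2 = 4 * s ^ 4 + t ^ 4"
    using step[of p r] step[of r p] prk cpr pr a2
    by (auto simp: mult.commute coprime_commute add.commute)
  have "odd t"
  proof
    assume "even t"
    then have "even (a\<^sup>2)" unfolding st(4) by simp
    with \<open>odd a\<close> show False by simp
  qed
  then have "even (a - t\<^sup>2)" using \<open>odd a\<close> by simp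
  then obtain U where U: "a - t\<^sup>2 = 2 * U" by (rule evenE)
  define V where "V = U + t\<^sup>2"
  have UV: "U * V = s ^ 4"
  proof -
    have "4 * (U * V) = a\<^sup>2 - t ^ 4"
      using U unfolding V_def by algebra
    then show ?thesis using st(4) by simp
  qed
  have a: "a = U + V" using U by (simp add: V_def)
  have "U * V > 0" unfolding UV using st by simp
  moreover have "V > U" using st by (simp add: V_def)
  ultimately have posUV: "U > 0" "V > 0"
    using ab(1) a by (auto simp: zero_less_mult_iff)
  have "coprime U V"
  proof -
    have "U dvd s ^ 4" using UV by (metis dvd_triv_left)
    moreover have "coprime (s ^ 4) (t\<^sup>2)" using st by simp
    ultimately have "coprime U (t\<^sup>2)"
      by (rule coprime_divisors[OF _ dvd_refl])
    then show ?thesis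
      by (simp only: V_def coprime_iff_gcd_eq_1 gcd_add2)
  qed
  then obtain h g where gh: "h > 0" "g > 0" "U = h ^ 4" "V = g ^ 4"
    using coprime_mult_eq_power[OF _ UV posUV st(1)] by blast
  have "g \<le> g ^ 4" using gh by (simp add: self_le_power)
  also have "\<dots> < a" using a gh(4) posUV by simp
  finally have "nat g < nat a" using gh by simp
  moreover have "coprime g h"
    using \<open>coprime U V\<close> gh by (simp add: coprime_commute)
  moreover have "g ^ 4 - h ^ 4 = t\<^sup>2"
    using gh by (simp add: V_def)
  ultimately show False
    using less.hyps \<open>odd t\<close> gh st by blast
qed

text \<open>For \<open>u^2 = 2b + 1\<close> the equation reads \<open>v^4 = (b + 1)^2 + b^2\<close>,
  so \<open>(b + 1)^4 - b^4 = (v^2 u)^2\<close>, which the descent excludes for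
  \<open>b > 0\<close>.\<close>

lemma biquadrate_plus_one_eq_twice_biquadrate:
  fixes u v :: int
  assumes "u ^ 4 + 1 = 2 * v ^ 4" "u > 0"
  shows "u = 1"
proof (rule ccontr)
  assume "u \<noteq> 1"
  have "odd (u ^ 4)"
    using assms(1) by (metis dvd_triv_left even_plus_one_iff)
  then have "odd (u\<^sup>2)" by simp
  then obtain b where b: "u\<^sup>2 = 2 * b + 1" by (rule oddE)
  have "1 < u\<^sup>2" using \<open>u \<noteq> 1\<close> \<open>u > 0\<close> by (simp add: one_less_power)
  then have "b > 0" using b by simp
  have "u ^ 4 = (u\<^sup>2)\<^sup>2" by simp
  then have v4: "v ^ 4 = 2 * (b\<^sup>2 + b) + 1"
    using assms(1) unfolding b by (simp add: power2_eq_square algebra_simps)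
  then have "odd (v ^ 4)" by simp
  then have "odd v" by simp
  have "(b + 1) ^ 4 - b ^ 4 = (2 * (b\<^sup>2 + b) + 1) * (2 * b + 1)"
    by (simp add: eval_nat_numeral algebra_simps)
  also have "\<dots> = (v\<^sup>2 * u)\<^sup>2"
    by (simp only: v4[symmetric] b[symmetric] power_mult_distrib) simp
  finally have "(b + 1) ^ 4 - b ^ 4 = (v\<^sup>2 * u)\<^sup>2" .
  moreover have "coprime (b + 1) b" by simp
  moreover have "odd (v\<^sup>2 * u)" using \<open>odd v\<close> \<open>odd (u\<^sup>2)\<close> by simp
  moreover have "v\<^sup>2 * u > 0" using \<open>odd v\<close> \<open>u > 0\<close> by (auto simp: zero_less_mult_iff)
  ultimately show False
    using no_biquadrate_difference_odd_square[of "b + 1" b "v\<^sup>2 * u"] \<open>b > 0\<close> by simp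
qed

lemma square_power_plus_one_eq_twice_square_power:
  fixes u v :: int
  assumes eq: "(u ^ q)\<^sup>2 + 1 = 2 * (v ^ q)\<^sup>2" and "q \<ge> 2" "u > 0" "v > 0"
  shows "u ^ q = 1"
proof (cases "even q")
  case True
  then obtain r where "q = 2 * r" by (rule evenE)
  then have "(u ^ r) ^ 4 + 1 = 2 * (v ^ r) ^ 4"
    using eq by (simp add: mult.commute flip: power_mult)
  then have "u ^ r = 1"
    using biquadrate_plus_one_eq_twice_biquadrate \<open>u > 0\<close> by simp
  then show ?thesis
    using \<open>q = 2 * r\<close> by (simp add: mult.commute power_mult)
next
  case False
  have "(u ^ q)\<^sup>2 + 1 = 2 * (v\<^sup>2) ^ q"
    using eq by (simp add: mult.commute flip: power_mult)
  then have "v\<^sup>2 = 1"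
    by (rule square_plus_one_eq_twice_power) (use False \<open>q \<ge> 2\<close> \<open>v > 0\<close> in auto)
  then have "v = 1"
    using \<open>v > 0\<close> by (simp add: power2_eq_1_iff)
  then have "(u ^ q)\<^sup>2 = 1" using eq by simp
  moreover have "u ^ q > 0" using \<open>u > 0\<close> by simp
  ultimately show ?thesis by (simp add: power2_eq_1_iff)
qed

section \<open>Balancing numbers\<close>

text \<open>The sequence 1, 3, 17, 99, ... of solutions \<open>C\<close> of \<open>C^2 = 8 B^2 + 1\<close>.\<close>

definition lucas_balancing :: "nat \<Rightarrow> int" where
  "lucas_balancing n = balancing (Suc n) - 3 * balancing n"

lemma balancing_Suc: "balancing (Suc n) = 3 * balancing n + lucas_balancing n"
  by (simp add: lucas_balancing_def)

lemma lucas_balancing_0 [simp]: "lucas_balancing 0 = 1"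
  by (simp add: lucas_balancing_def)

lemma lucas_balancing_Suc: "lucas_balancing (Suc n) = 8 * balancing n + 3 * lucas_balancing n"
  by (simp add: lucas_balancing_def)

lemma balancing_small: "balancing 1 = 1" "balancing 2 = 6"
proof -
  show "balancing 1 = 1" by simp
  show "balancing 2 = 6" by (simp add: numeral_2_eq_2)
qed

lemma lucas_balancing_square: "(lucas_balancing n)\<^sup>2 = 8 * (balancing n)\<^sup>2 + 1"
proof (induction n)
  case (Suc n)
  then show ?case
    unfolding lucas_balancing_Suc balancing_Suc by algebra
qed simp

text \<open>Multiplicativity of \<open>(3 + sqrt 8)^n = C_n + B_n sqrt 8\<close>. The recursion
  couples both sequences, hence one joint induction.\<close>

lemma balancing_add_aux:
  "balancing (m + n) = balancing m * lucas_balancing n + lucas_balancing m * balancing n \<and>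
   lucas_balancing (m + n) = lucas_balancing m * lucas_balancing n + 8 * balancing m * balancing n"
proof (induction m)
  case (Suc m)
  then have B: "balancing (m + n) = balancing m * lucas_balancing n + lucas_balancing m * balancing n"
    and C: "lucas_balancing (m + n) = lucas_balancing m * lucas_balancing n + 8 * balancing m * balancing n"
    by blast+
  show ?case
    unfolding add_Suc balancing_Suc lucas_balancing_Suc B C by (simp add: algebra_simps)
qed simp

lemmas balancing_add = balancing_add_aux[THEN conjunct1]
  and lucas_balancing_add = balancing_add_aux[THEN conjunct2]

lemma balancing_double: "balancing (2 * n) = 2 * balancing n * lucas_balancing n"
  unfolding mult_2[of n] balancing_add by (simp add: algebra_simps)

lemma balancing_nonneg_lucas_balancing_pos: "balancing n \<ge> 0 \<and> lucas_balancing n > 0"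
proof (induction n)
  case (Suc n)
  then show ?case
    unfolding lucas_balancing_Suc balancing_Suc by linarith
qed simp

lemmas balancing_nonneg = balancing_nonneg_lucas_balancing_pos[THEN conjunct1]
  and lucas_balancing_pos = balancing_nonneg_lucas_balancing_pos[THEN conjunct2]

lemma balancing_pos:
  assumes "n > 0"
  shows "balancing n > 0"
proof -
  obtain k where k: "n = Suc k" using assms by (cases n) auto
  show ?thesis
    using balancing_nonneg[of k] lucas_balancing_pos[of k] unfolding k balancing_Suc by linarith
qed

lemma balancing_eq_1_iff: "balancing n = 1 \<longleftrightarrow> n = 1"
proof
  assume eq: "balancing n = 1"
  show "n = 1"
  proof (rule ccontr)
    assume "n \<noteq> 1"
    moreover have "n \<noteq> 0" using eq by (cases n) auto
    ultimately obtain k where "n = Suc k" "k > 0" by (cases n) auto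
    then show False
      using eq balancing_pos[of k] lucas_balancing_pos[of k] by (simp add: balancing_Suc)
  qed
qed simp

section \<open>Divisibility among balancing numbers\<close>

lemma odd_lucas_balancing: "odd (lucas_balancing n)"
proof -
  have "odd ((lucas_balancing n)\<^sup>2)"
    unfolding lucas_balancing_square by simp
  then show ?thesis by simp
qed

lemma coprime_balancing_lucas_balancing: "coprime (balancing n) (lucas_balancing n)"
proof (rule coprimeI)
  fix c assume c: "c dvd balancing n" "c dvd lucas_balancing n"
  have "1 = lucas_balancing n * lucas_balancing n - balancing n * (8 * balancing n)"
    using lucas_balancing_square[of n] by (simp add: power2_eq_square)
  also have "c dvd \<dots>" using c by (intro dvd_diff dvd_mult2)
  finally show "is_unit c" .
qed

text \<open>Modulo \<open>balancing n\<close> the addition formula leaves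
  \<open>balancing m * lucas_balancing n\<close>, whose second factor is coprime to
  \<open>balancing n\<close>.\<close>

lemma gcd_balancing_add:
  "gcd (balancing (m + n)) (balancing n) = gcd (balancing m) (balancing n)"
proof -
  have "gcd (balancing (m + n)) (balancing n)
      = gcd (balancing n) (lucas_balancing m * balancing n + balancing m * lucas_balancing n)"
    by (simp only: balancing_add[of m n] gcd.commute add.commute)
  also have "\<dots> = gcd (balancing n) (balancing m * lucas_balancing n)"
    by (rule gcd_add_mult)
  also have "\<dots> = gcd (balancing n) (balancing m)"
    using coprime_balancing_lucas_balancing by (rule gcd_mult_right_right_cancel)
  finally show ?thesis by (simp only: gcd.commute)
qed

text \<open>The subtractive Euclidean algorithm, run on the indices.\<close>

lemma gcd_balancing: "gcd (balancing m) (balancing n) = balancing (gcd m n)"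
proof (induction "m + n" arbitrary: m n rule: less_induct)
  case less
  consider "m = 0" | "n = 0" | "n \<le> m" "n > 0" | "m \<le> n" "m > 0" by linarith
  then show ?case
  proof cases
    case 3
    then obtain k where k: "m = k + n" by (metis le_add_diff_inverse2)
    then have "gcd (balancing k) (balancing n) = balancing (gcd k n)"
      using less 3 by simp
    then show ?thesis by (simp only: k gcd_balancing_add gcd_add1)
  next
    case 4
    then obtain k where k: "n = k + m" by (metis le_add_diff_inverse2)
    then have "gcd (balancing k) (balancing m) = balancing (gcd k m)"
      using less 4 by simp
    then show ?thesis
      by (simp only: k gcd_balancing_add gcd_add1 gcd.commute[of _ "balancing (k + m)"]
        gcd.commute[of _ "k + m"])
  qed (simp_all add: balancing_nonneg)
qed

lemma coprime_balancing:
  assumes "coprime m n"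
  shows "coprime (balancing m) (balancing n)"
proof -
  have "gcd m n = 1" using assms by simp
  then have "gcd (balancing m) (balancing n) = 1"
    by (simp only: gcd_balancing balancing_small(1))
  then show ?thesis by (simp only: coprime_iff_gcd_eq_1)
qed

text \<open>The analogue of \<open>sin^2 x - sin^2 y = sin (x - y) sin (x + y)\<close>, from the
  addition formulas and the Pell equation.\<close>

lemma balancing_square_diff:
  assumes "m \<le> n"
  shows "(balancing n)\<^sup>2 - (balancing m)\<^sup>2 = balancing (n - m) * balancing (n + m)"
proof -
  obtain d where d: "n = m + d" using assms by (metis le_add_diff_inverse)
  have "(balancing n)\<^sup>2 - (balancing m)\<^sup>2 = balancing d * balancing (m + (m + d))"
    using lucas_balancing_square[of m] lucas_balancing_square[of d]
    unfolding d balancing_add lucas_balancing_add by algebra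
  then show ?thesis by (simp add: d add.commute)
qed

lemma six_dvd_balancing:
  assumes "even n"
  shows "6 dvd balancing n"
proof -
  have "gcd n 2 = 2" using assms by (simp add: gcd_nat.absorb2)
  then have "gcd (balancing n) 6 = 6"
    using gcd_balancing[of n 2] by (simp only: balancing_small(2))
  then show ?thesis by (metis gcd_dvd1)
qed

lemma coprime_balancing_6:
  assumes "odd n"
  shows "coprime (balancing n) 6"
proof -
  have "coprime n 2" using assms by simp
  then show ?thesis
    using coprime_balancing[of n 2] by (simp only: balancing_small(2))
qed

section \<open>Perfect powers among balancing numbers and their multiples\<close>

lemma balancing_odd_index_power:
  assumes "odd k" "balancing k = y ^ q" "q \<ge> 2" "y > 0"
  shows "k = 1"
proof -
  obtain j where j: "k = 2 * j + 1" using assms(1) by (rule oddE)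
  define b c where "b = balancing j" and "c = lucas_balancing j"
  have bc: "b \<ge> 0" "c > 0" by (simp_all add: b_def c_def balancing_nonneg lucas_balancing_pos)
  have pell: "c\<^sup>2 = 8 * b\<^sup>2 + 1" by (simp add: b_def c_def lucas_balancing_square)
  \<comment> \<open>With \<open>balancing (j + 1) = 3b + c\<close>, the factors are the difference
    and the sum of two consecutive balancing numbers.\<close>
  have eq: "(2 * b + c) * (4 * b + c) = y ^ q"
  proof -
    have "balancing k = 3 * balancing (j + j) + lucas_balancing (j + j)"
      by (simp add: j balancing_Suc mult_2 del: balancing.simps(3))
    also have "\<dots> = (2 * b + c) * (4 * b + c)"
      unfolding balancing_add lucas_balancing_add b_def[symmetric] c_def[symmetric]
      by (simp add: algebra_simps)
    finally show ?thesis using assms(2) by simp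
  qed
  have neg_pell: "(4 * b + c)\<^sup>2 + 1 = 2 * (2 * b + c)\<^sup>2"
    using pell by algebra
  have "coprime (2 * b + c) (4 * b + c)"
  proof (rule coprimeI)
    fix g assume g: "g dvd 2 * b + c" "g dvd 4 * b + c"
    have "1 = (2 * b + c) * (2 * (2 * b + c)) - (4 * b + c) * (4 * b + c)"
      using neg_pell by (simp add: power2_eq_square algebra_simps)
    also have "g dvd \<dots>" using g by (intro dvd_diff dvd_mult2)
    finally show "is_unit g" .
  qed
  then obtain v u where uv: "v > 0" "u > 0" "2 * b + c = v ^ q" "4 * b + c = u ^ q"
    using coprime_mult_eq_power[OF _ eq] bc assms(4) by auto
  then have "u ^ q = 1"
    using square_power_plus_one_eq_twice_square_power[of u q v] neg_pell assms(3) by simp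
  then have "b = 0" using uv bc by linarith
  then have "j = 0" using balancing_pos[of j] by (cases j) (auto simp: b_def)
  then show ?thesis by (simp add: j)
qed

text \<open>This serves the case \<open>n - m = 2\<close>, where \<open>balancing 2\<close>
  contributes 6. The exponent \<open>e\<close> is free because every duplication adds a factor
  2.\<close>

lemma three_two_power_balancing_not_power:
  assumes "4 dvd l" "l > 0" "3 * 2 ^ e * balancing l = y ^ q" "q \<ge> 2" "y > 0"
  shows False
  using assms
proof (induction l arbitrary: e y rule: less_induct)
  case (less l)
  then obtain r where r: "l = 2 * r" "even r" "r > 0"
    by (auto elim!: dvdE)
  \<comment> \<open>Halving the index keeps the shape of the equation; when \<open>r\<close> is no longer divisible by 4 it
    must be 2, and \<open>lucas_balancing 2 = 17\<close> is not a power.\<close>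
  let ?a = "3 * 2 ^ Suc e * balancing r"
  have cop: "coprime ?a (lucas_balancing r)"
  proof -
    have "3 dvd balancing r"
      using six_dvd_balancing[OF r(2)] by (rule dvd_trans[rotated]) simp
    then have "coprime 3 (lucas_balancing r)"
      using coprime_balancing_lucas_balancing by (rule coprime_divisors[OF _ dvd_refl])
    moreover have "coprime 2 (lucas_balancing r)"
      using odd_lucas_balancing[of r] by simp
    ultimately show ?thesis
      using coprime_balancing_lucas_balancing[of r]
      by (simp only: coprime_mult_left_iff coprime_power_left_iff) simp
  qed
  have "?a > 0" using balancing_pos[OF r(3)] by simp
  have "?a * lucas_balancing r = y ^ q"
    using less.prems(3) by (simp add: r balancing_double)
  then obtain d c where dc: "d > 0" "c > 0" "?a = d ^ q" "lucas_balancing r = c ^ q"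
    using coprime_mult_eq_power[OF cop _ \<open>?a > 0\<close> lucas_balancing_pos less.prems(5)] by metis
  show False
  proof (cases "4 dvd r")
    case True
    then show False
      using less.IH[of r "Suc e" d] r dc less.prems(4) by simp
  next
    case False
    obtain j where j: "r = 2 * j" using r(2) by (rule evenE)
    then have "odd j" "j > 0" using False r(3) by auto
    have "coprime (balancing j) 2" "coprime (balancing j) 3"
      using coprime_balancing_6[OF \<open>odd j\<close>] coprime_mult_right_iff[of "balancing j" 2 3] by simp_all
    \<comment> \<open>For odd \<open>j\<close> the number \<open>balancing j\<close> is prime to 6
      and splits off as a power.\<close>
    then have "coprime (balancing j) (3 * 2 ^ (Suc (Suc e)) * lucas_balancing j)"
      using coprime_balancing_lucas_balancing[of j]
      by (simp only: coprime_mult_right_iff coprime_power_right_iff) simp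
    moreover have "balancing j * (3 * 2 ^ (Suc (Suc e)) * lucas_balancing j) = d ^ q"
      using dc(3) unfolding j balancing_double by (simp add: mult_ac)
    ultimately obtain f where "f > 0" "balancing j = f ^ q"
      using coprime_mult_eq_power[of "balancing j" "3 * 2 ^ (Suc (Suc e)) * lucas_balancing j" d q]
        balancing_pos[OF \<open>j > 0\<close>] lucas_balancing_pos[of j] dc(1) by auto
    then have "j = 1"
      using balancing_odd_index_power \<open>odd j\<close> less.prems(4) by blast
    then have "c ^ q = 17"
      using dc(4) j by (simp add: lucas_balancing_def eval_nat_numeral)
    \<comment> \<open>An exponent of at least 2 produces a square divisor, but 17 is
      squarefree.\<close>
    moreover have "c ^ 2 dvd c ^ q" using less.prems(4) by (rule le_imp_power_dvd)
    ultimately have c: "c\<^sup>2 dvd 17" by simp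
    have "c < 5"
    proof (rule ccontr)
      assume "\<not> c < 5"
      then have "25 \<le> c\<^sup>2" using power_mono[of 5 c 2] by simp
      with zdvd_imp_le[OF c] show False by simp
    qed
    then have "c \<in> {1, 2, 3, 4}" using dc(2) by auto
    with c \<open>c ^ q = 17\<close> show False by auto
  qed
qed

theorem theorem1p2:
  shows "(\<forall>(n::nat) (m::nat) (x::int) (q::nat).
            m < n \<and> 0 < x \<and> 2 \<le> q
            \<and> gcd (balancing n) (balancing m) = 1
            \<and> (balancing n)\<^sup>2 - (balancing m)\<^sup>2 = x ^ q
            \<longrightarrow> (\<exists>k\<ge>2. (n, m, x, q) = (1, 0, 1, k)) \<or> (n, m, x, q) = (2, 0, 6, 2))
       \<and> (\<forall>k\<ge>(2::nat). gcd (balancing 1) (balancing 0) = 1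
            \<and> (balancing 1)\<^sup>2 - (balancing 0)\<^sup>2 = 1 ^ k)
       \<and> (balancing 2)\<^sup>2 - (balancing 0)\<^sup>2 = 6 ^ 2"
proof (intro conjI allI impI)
  fix n m q :: nat and x :: int
  assume "m < n \<and> 0 < x \<and> 2 \<le> q \<and> gcd (balancing n) (balancing m) = 1
            \<and> (balancing n)\<^sup>2 - (balancing m)\<^sup>2 = x ^ q"
  then have mn: "m < n" and x: "0 < x" and q: "2 \<le> q"
    and "gcd (balancing n) (balancing m) = 1"
    and "(balancing n)\<^sup>2 - (balancing m)\<^sup>2 = x ^ q" by auto
  then have cop: "coprime n m" and eq: "balancing (n - m) * balancing (n + m) = x ^ q"
    by (simp_all add: gcd_balancing balancing_eq_1_iff balancing_square_diff coprime_iff_gcd_eq_1)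
  have pos: "balancing (n - m) > 0" "balancing (n + m) > 0"
    using mn by (simp_all add: balancing_pos)
  show "(\<exists>k\<ge>2. (n, m, x, q) = (1, 0, 1, k)) \<or> (n, m, x, q) = (2, 0, 6, 2)"
  proof (cases "even (n + m)")
    case False
    have "coprime (n - m) (n + m)"
    proof (rule coprimeI)
      fix g assume g: "g dvd n - m" "g dvd n + m"
      have "odd g" using g(2) False by (meson dvd_trans)
      have "g dvd (n - m) + (n + m)" "g dvd (n + m) - (n - m)"
        using g by (blast intro: dvd_add dvd_diff_nat)+
      then have "g dvd n * 2" "g dvd m * 2"
        using mn by (simp_all add: mult_2_right)
      then have "g dvd n" "g dvd m"
        using \<open>odd g\<close> by (simp_all add: coprime_dvd_mult_left_iff)
      with cop show "is_unit g" by (rule coprime_common_divisor)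
    qed
    \<comment> \<open>Both factors are powers, and the odd index \<open>n + m\<close> must then be
      1.\<close>
    then obtain d e where "d > 0" "e > 0" "balancing (n - m) = d ^ q" "balancing (n + m) = e ^ q"
      using coprime_mult_eq_power[OF coprime_balancing eq pos x] by blast
    then have "n + m = 1"
      using balancing_odd_index_power[of "n + m"] False q by blast
    then have "n = 1" "m = 0" using mn by auto
    then have "x ^ q = 1" using eq by simp
    then have "x = 1" using power_eq_iff_eq_base[of q x 1] x q by simp
    then show ?thesis using \<open>n = 1\<close> \<open>m = 0\<close> q by simp
  next
    case True
    \<comment> \<open>Coprime indices of equal parity are odd, so the half-difference
      \<open>k\<close> and the half-sum \<open>l\<close> have opposite parity; the odd one yields a
      power.\<close>
    have "odd m" "odd n"
      using True cop by (metis coprime_common_divisor even_add odd_one)+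
    define k l where "k = (n - m) div 2" and "l = (n + m) div 2"
    have kl: "n - m = 2 * k" "n + m = 2 * l"
      using True mn by (auto simp: k_def l_def)
    have n: "n = l + k" and m: "m = l - k" and "k < l" "k > 0"
      using kl mn \<open>odd m\<close> by (auto elim: oddE)
    have "coprime l k"
    proof (rule coprimeI)
      fix g assume "g dvd l" "g dvd k"
      then have "g dvd n" "g dvd m" by (auto simp: n m intro: dvd_diff_nat)
      with cop show "is_unit g" by (rule coprime_common_divisor)
    qed
    have "even l \<longleftrightarrow> odd k" using \<open>odd n\<close> n by auto
    show ?thesis
    proof (cases "odd l")
      case True
      \<comment> \<open>Duplication of \<open>balancing (2 * l)\<close> exposes the factor
        \<open>balancing l\<close>; the resulting \<open>l = 1\<close> contradicts
        \<open>0 < k < l\<close>.\<close>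
      have "coprime (balancing l) (balancing (2 * k) * 2 * lucas_balancing l)"
        using coprime_balancing[of l "2 * k"] True \<open>coprime l k\<close> coprime_balancing_6[OF True]
          coprime_balancing_lucas_balancing[of l] coprime_mult_right_iff[of "balancing l" 2 3]
        by simp
      moreover have "balancing l * (balancing (2 * k) * 2 * lucas_balancing l) = x ^ q"
        using eq unfolding kl balancing_double[of l] by (simp add: mult_ac)
      ultimately obtain d where "d > 0" "balancing l = d ^ q"
        using coprime_mult_eq_power[of "balancing l" "balancing (2 * k) * 2 * lucas_balancing l" x q]
          pos kl x lucas_balancing_pos[of l] balancing_pos[of l] \<open>k < l\<close> by auto
      then have "l = 1" using balancing_odd_index_power True q by blast
      with \<open>k < l\<close> \<open>k > 0\<close> show ?thesis by simp
    next
      case False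
      then have "odd k" using \<open>even l \<longleftrightarrow> odd k\<close> by simp
      \<comment> \<open>Here \<open>k = 1\<close> is compatible with \<open>k < l\<close> and leaves
        \<open>6 * balancing (2 * l)\<close> with \<open>l\<close> even.\<close>
      have "coprime (balancing k) (balancing (2 * l) * 2 * lucas_balancing k)"
        using coprime_balancing[of k "2 * l"] \<open>odd k\<close> \<open>coprime l k\<close> coprime_balancing_6[OF \<open>odd k\<close>]
          coprime_balancing_lucas_balancing[of k] coprime_mult_right_iff[of "balancing k" 2 3]
        by (simp add: coprime_commute)
      moreover have "balancing k * (balancing (2 * l) * 2 * lucas_balancing k) = x ^ q"
        using eq unfolding kl balancing_double[of k] by (simp add: mult_ac)
      ultimately obtain d where "d > 0" "balancing k = d ^ q"
        using coprime_mult_eq_power[of "balancing k" "balancing (2 * l) * 2 * lucas_balancing k" x q]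
          pos kl x lucas_balancing_pos[of k] balancing_pos[of k] \<open>k > 0\<close> by auto
      then have "k = 1" using balancing_odd_index_power \<open>odd k\<close> q by blast
      then have "3 * 2 ^ 1 * balancing (2 * l) = x ^ q"
        using eq balancing_small(2) unfolding kl by simp
      moreover have "4 dvd 2 * l" using False by auto
      ultimately show ?thesis
        using three_two_power_balancing_not_power[of "2 * l" 1 x q] \<open>k < l\<close> q x by simp
    qed
  qed
next
  fix k :: nat
  show "gcd (balancing 1) (balancing 0) = 1" by simp
  show "(balancing 1)\<^sup>2 - (balancing 0)\<^sup>2 = 1 ^ k" by simp
next
  show "(balancing 2)\<^sup>2 - (balancing 0)\<^sup>2 = 6 ^ 2"
    by (simp add: balancing_small(2))
qed

end
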